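(* Let $\mu,\nu>0$ with $\mu+\nu=1$, let $N\ge1$ be an integer, and let $(E_N(t))_{t\ge 0}$ be the Ehrenfest process with $N$ particles and parameters $\nu,\mu$. For $0\le x\le N$ let $T_x^{E_N}=\inf\{t>0:E_N(t)=x\}$ and, for $\alpha>0$, define $$B_x(\alpha)=\int_0^1(1-u)^x\left(1+\frac{\nu}{\mu}u\right)^{N-x}u^{\alpha-1}\,du,\qquad D_x(\alpha)=\int_0^1(1-u)^{N-x}\left(1+\frac{\mu}{\nu}u\right)^{x}u^{\alpha-1}\,du.$$ Then for all integers $0\le x\le y\le N$ and all $\alpha>0$, $$\mathbb{E}_y\left(e^{-\alpha T_x^{E_N}}\right)=\frac{B_y(\alpha)}{B_x(\alpha)}\qquad\text{and}\qquad \mathbb{E}_x\left(e^{-\alpha T_y^{E_N}}\right)=\frac{D_x(\alpha)}{D_y(\alpha)}.$$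
   Context: The Ehrenfest process $(E_N(t))_{t\ge0}$ with $N$ particles and parameters $\nu,\mu>0$ is the continuous-time (right-continuous) birth and death Markov process on $\{0,1,\ldots,N\}$ with transition rates $q(x,x+1)=\nu(N-x)$ and $q(x,x-1)=\mu x$ for $0\le x\le N$. The time scale is normalized so that $\mu+\nu=1$. $\mathbb{E}_z$ denotes expectation when the process starts at $E_N(0)=z$. *)

theory Defs
  imports "HOL-Probability.Probability"
begin

definition transition_semigroup :: "'s set \<Rightarrow> (real \<Rightarrow> 's \<Rightarrow> 's \<Rightarrow> real) \<Rightarrow> bool" where
  "transition_semigroup S P \<longleftrightarrow>
     (\<forall>t\<ge>0. \<forall>x\<in>S. (\<forall>y\<in>S. 0 \<le> P t x y) \<and> (\<Sum>y\<in>S. P t x y) = 1) \<and>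
     (\<forall>x\<in>S. \<forall>y\<in>S. P 0 x y = (if x = y then 1 else 0)) \<and>
     (\<forall>s\<ge>0. \<forall>t\<ge>0. \<forall>x\<in>S. \<forall>z\<in>S. P (s + t) x z = (\<Sum>y\<in>S. P s x y * P t y z))"

text \<open>
  Only the off-diagonal rates are prescribed. On a finite state space the row sums of \<open>P h\<close>
  being 1 then force the derivative of \<open>P h x x\<close> at \<open>h = 0\<close> to be minus the total jump rate out
  of \<open>x\<close>.
\<close>

definition has_transition_rates ::
    "'s set \<Rightarrow> (real \<Rightarrow> 's \<Rightarrow> 's \<Rightarrow> real) \<Rightarrow> ('s \<Rightarrow> 's \<Rightarrow> real) \<Rightarrow> bool" where
  "has_transition_rates S P q \<longleftrightarrow>
     (\<forall>x\<in>S. \<forall>y\<in>S. x \<noteq> y \<longrightarrow> ((\<lambda>h. P h x y / h) \<longlongrightarrow> q x y) (at_right 0))"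

definition markov_with_semigroup ::
    "'a measure \<Rightarrow> 's set \<Rightarrow> (real \<Rightarrow> 's \<Rightarrow> 's \<Rightarrow> real) \<Rightarrow> (real \<Rightarrow> 'a \<Rightarrow> 's) \<Rightarrow> bool" where
  "markov_with_semigroup M S P X \<longleftrightarrow>
     (\<forall>n (t :: nat \<Rightarrow> real) s.
        0 \<le> t 0 \<longrightarrow> (\<forall>i\<le>n. t i < t (Suc i)) \<longrightarrow> (\<forall>i\<le>Suc n. s i \<in> S) \<longrightarrow>
        \<P>(\<omega> in M. \<forall>i\<le>n. X (t i) \<omega> = s i) > 0 \<longrightarrow>
        \<P>(\<omega> in M. X (t (Suc n)) \<omega> = s (Suc n) \<bar> \<forall>i\<le>n. X (t i) \<omega> = s i)
          = P (t (Suc n) - t n) (s n) (s (Suc n)))"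

text \<open>The state space is finite and carries the discrete topology, so right-continuity means that
  each path is constant on some interval \<open>[t, t + \<epsilon>)\<close>. The initial law is arbitrary.\<close>

definition markov_jump_process ::
    "'a measure \<Rightarrow> 's::discrete_topology set \<Rightarrow> ('s \<Rightarrow> 's \<Rightarrow> real) \<Rightarrow> (real \<Rightarrow> 'a \<Rightarrow> 's) \<Rightarrow> bool" where
  "markov_jump_process M S q X \<longleftrightarrow>
     prob_space M \<and> finite S \<and>
     (\<forall>t\<ge>0. X t \<in> M \<rightarrow>\<^sub>M count_space S) \<and>
     (\<forall>\<omega>\<in>space M. \<forall>t\<ge>0. continuous (at_right t) (\<lambda>r. X r \<omega>)) \<and>
     (\<exists>P. transition_semigroup S P \<and> has_transition_rates S P q \<and> markov_with_semigroup M S P X)"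

definition ehrenfest_rate :: "nat \<Rightarrow> real \<Rightarrow> real \<Rightarrow> nat \<Rightarrow> nat \<Rightarrow> real" where
  "ehrenfest_rate N \<nu> \<mu> x y =
     (if y = x + 1 then \<nu> * (real N - real x) else if x = y + 1 then \<mu> * real x else 0)"

definition ehrenfest_process ::
    "'a measure \<Rightarrow> nat \<Rightarrow> real \<Rightarrow> real \<Rightarrow> (real \<Rightarrow> 'a \<Rightarrow> nat) \<Rightarrow> bool" where
  "ehrenfest_process M N \<nu> \<mu> X \<longleftrightarrow> markov_jump_process M {0..N} (ehrenfest_rate N \<nu> \<mu>) X"

text \<open>Extended-real valued, so that the hitting time is \<open>\<infinity>\<close> on paths that never reach \<open>x\<close>.\<close>

definition hitting_time :: "(real \<Rightarrow> 'a \<Rightarrow> 's) \<Rightarrow> 's \<Rightarrow> 'a \<Rightarrow> ereal" where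
  "hitting_time X x \<omega> = Inf {ereal t | t. 0 < t \<and> X t \<omega> = x}"

text \<open>For \<open>\<alpha> > 0\<close> and \<open>T\<close> in \<open>[0, \<infinity>]\<close> this is \<open>exp (- \<alpha> T)\<close> with \<open>exp (- \<infinity>) = 0\<close>.\<close>

definition discount :: "real \<Rightarrow> ereal \<Rightarrow> real" where
  "discount \<alpha> T = (if T = \<infinity> then 0 else exp (- \<alpha> * real_of_ereal T))"

definition ehrenfest_B :: "nat \<Rightarrow> real \<Rightarrow> real \<Rightarrow> nat \<Rightarrow> real \<Rightarrow> real" where
  "ehrenfest_B N \<nu> \<mu> x \<alpha> =
     (LBINT u:{0..1}. (1 - u) ^ x * (1 + \<nu> / \<mu> * u) ^ (N - x) * u powr (\<alpha> - 1))"

definition ehrenfest_D :: "nat \<Rightarrow> real \<Rightarrow> real \<Rightarrow> nat \<Rightarrow> real \<Rightarrow> real" where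
  "ehrenfest_D N \<nu> \<mu> x \<alpha> =
     (LBINT u:{0..1}. (1 - u) ^ (N - x) * (1 + \<mu> / \<nu> * u) ^ x * u powr (\<alpha> - 1))"

end

theory Submission
  imports Defs "HOL-Real_Asymp.Real_Asymp"
begin

text \<open>
  Suppose \<open>F x = 1\<close> and \<open>\<Sum>\<^sub>y q(z, y) (F y - F z) = \<alpha> F z\<close> for all \<open>z \<noteq> x\<close>. Along the process sampled
  at the times \<open>kh\<close> and stopped at its first visit to \<open>x\<close>, the discounted value \<open>e\<^sup>-\<^sup>\<alpha>\<^sup>k\<^sup>h F\<close> is a
  martingale up to an error \<open>o(h)\<close> per step. The discounted errors add up to
  \<open>o(h) / (1 - e\<^sup>-\<^sup>\<alpha>\<^sup>h) = o(1)\<close>, and by right-continuity the sampled hitting times converge to the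
  true one as \<open>h \<rightarrow> 0\<close>, so \<open>\<E>\<^sub>z e\<^sup>-\<^sup>\<alpha>\<^sup>T = F z\<close>.

  For the Ehrenfest rates, \<open>F\<close> is \<open>B\<^sub>z / B\<^sub>x\<close> to the right of \<open>x\<close> and \<open>D\<^sub>z / D\<^sub>x\<close> to the left of it.
  The generator maps \<open>\<phi>\<^sub>z(u) = (1 - u)\<^sup>z (1 + \<nu>u/\<mu>)\<^sup>N\<^sup>-\<^sup>z\<close>, as a function of \<open>z\<close>, to \<open>- u \<phi>\<^sub>z'(u)\<close>, and
  integration by parts against \<open>u\<^sup>\<alpha>\<^sup>-\<^sup>1\<close> turns this into \<open>\<alpha> B\<^sub>z\<close> when \<open>z > 0\<close>, because then
  \<open>\<phi>\<^sub>z(1) = 0\<close>. The identity for \<open>D\<close> follows by exchanging the two directions.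
\<close>

section \<open>Discounted sums along a killed discrete-time chain\<close>

text \<open>A discrete Dynkin formula. In \<open>step\<close> only mass outside \<open>x\<close> is
  passed on, so mass reaching \<open>x\<close> is counted once, at its arrival step, and then
  dropped. One step changes the discounted total by the defect
  \<open>c * (\<Sum>y\<in>S. p z y * F y) - F z\<close> weighted by \<open>w\<close>, and the
  changes telescope.\<close>

lemma discrete_killed_sum:
  fixes w :: "nat \<Rightarrow> 's \<Rightarrow> real"
  assumes "finite S" "x \<in> S"
    and step: "\<And>k z'. z' \<in> S \<Longrightarrow> w (Suc k) z' = (\<Sum>z\<in>S - {x}. w k z * p z z')"
  shows "(\<Sum>k<n. c ^ k * w k x * F x) + c ^ n * (\<Sum>z\<in>S. w n z * F z)
    = (\<Sum>z\<in>S. w 0 z * F z)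
      + (\<Sum>k<n. c ^ k * (\<Sum>z\<in>S - {x}. w k z * (c * (\<Sum>y\<in>S. p z y * F y) - F z)))"
proof (induction n)
  case 0
  then show ?case by simp
next
  case (Suc n)
  have "(\<Sum>z\<in>S. w (Suc n) z * F z) = (\<Sum>z'\<in>S. \<Sum>z\<in>S - {x}. w n z * p z z' * F z')"
    by (intro sum.cong) (auto simp: step sum_distrib_right)
  also have "\<dots> = (\<Sum>z\<in>S - {x}. w n z * (\<Sum>y\<in>S. p z y * F y))"
    by (subst sum.swap) (simp add: sum_distrib_left mult.assoc)
  finally have *: "c * (\<Sum>z\<in>S. w (Suc n) z * F z) =
      (\<Sum>z\<in>S - {x}. w n z * (c * (\<Sum>y\<in>S. p z y * F y) - F z)) + (\<Sum>z\<in>S - {x}. w n z * F z)"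
    by (simp add: sum_distrib_left right_diff_distrib sum_subtractf mult_ac)
  have **: "(\<Sum>z\<in>S. w n z * F z) = w n x * F x + (\<Sum>z\<in>S - {x}. w n z * F z)"
    using assms by (simp add: sum.remove)
  have "c ^ Suc n * (\<Sum>z\<in>S. w (Suc n) z * F z) = c ^ n * (c * (\<Sum>z\<in>S. w (Suc n) z * F z))"
    by simp
  then show ?case
    using Suc.IH unfolding * ** by (simp add: algebra_simps)
qed

text \<open>The weights \<open>w\<close> lie in [0, 1], so each step contributes at most the sum of
  the absolute defects, and the geometric series costs a factor 1 / (1 - \<open>c\<close>). The mass
  that has not reached \<open>x\<close> by step \<open>n\<close> accounts for the term with
  \<open>c ^ n\<close>.\<close>

lemma discrete_killed_sum_bound:
  fixes w :: "nat \<Rightarrow> 's \<Rightarrow> real"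
  assumes "finite S" "x \<in> S" "0 < c" "c < 1"
    and step: "\<And>k z'. z' \<in> S \<Longrightarrow> w (Suc k) z' = (\<Sum>z\<in>S - {x}. w k z * p z z')"
    and w: "\<And>k z. 0 \<le> w k z" "\<And>k z. w k z \<le> 1"
  shows "\<bar>(\<Sum>k<n. c ^ k * w k x * F x) - (\<Sum>z\<in>S. w 0 z * F z)\<bar>
    \<le> c ^ n * (\<Sum>z\<in>S. \<bar>F z\<bar>) + (\<Sum>z\<in>S - {x}. \<bar>c * (\<Sum>y\<in>S. p z y * F y) - F z\<bar>) / (1 - c)"
proof -
  define e where "e z = c * (\<Sum>y\<in>S. p z y * F y) - F z" for z
  have 1: "\<bar>\<Sum>z\<in>A. w k z * f z\<bar> \<le> (\<Sum>z\<in>A. \<bar>f z\<bar>)" for A k f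
    by (rule order_trans[OF sum_abs], rule sum_mono)
       (use w in \<open>simp add: abs_mult mult_left_le_one_le\<close>)
  have "\<bar>\<Sum>k<n. c ^ k * (\<Sum>z\<in>S - {x}. w k z * e z)\<bar>
      \<le> (\<Sum>k<n. c ^ k * (\<Sum>z\<in>S - {x}. \<bar>e z\<bar>))"
    by (rule order_trans[OF sum_abs], rule sum_mono)
       (use 1 assms(3) in \<open>simp add: abs_mult mult_left_mono\<close>)
  also have "\<dots> = (\<Sum>k<n. c ^ k) * (\<Sum>z\<in>S - {x}. \<bar>e z\<bar>)"
    by (simp add: sum_distrib_right)
  also have "\<dots> \<le> 1 / (1 - c) * (\<Sum>z\<in>S - {x}. \<bar>e z\<bar>)"
    using assms(3,4) by (intro mult_right_mono sum_nonneg) (auto simp: sum_gp_strict divide_right_mono)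
  finally have 2: "\<bar>\<Sum>k<n. c ^ k * (\<Sum>z\<in>S - {x}. w k z * e z)\<bar> \<le> (\<Sum>z\<in>S - {x}. \<bar>e z\<bar>) / (1 - c)"
    by simp
  have 3: "\<bar>c ^ n * (\<Sum>z\<in>S. w n z * F z)\<bar> \<le> c ^ n * (\<Sum>z\<in>S. \<bar>F z\<bar>)"
    using 1 assms(3) by (simp add: abs_mult mult_left_mono)
  have "(\<Sum>k<n. c ^ k * w k x * F x) + c ^ n * (\<Sum>z\<in>S. w n z * F z)
    = (\<Sum>z\<in>S. w 0 z * F z) + (\<Sum>k<n. c ^ k * (\<Sum>z\<in>S - {x}. w k z * e z))"
    unfolding e_def by (rule discrete_killed_sum[OF assms(1,2)]) (rule step)
  with 2 3 show ?thesis
    unfolding e_def[symmetric] by linarith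
qed

section \<open>Hitting times sampled on a grid\<close>

text \<open>At most one summand is nonzero, namely the one for the first grid index below
  \<open>n\<close> at which the path is at \<open>x\<close>; the value is 0 if there is none.
  Writing it as a sum makes its expectation a linear combination of probabilities of first
  visits.\<close>

definition grid_discount :: "real \<Rightarrow> real \<Rightarrow> nat \<Rightarrow> (real \<Rightarrow> 's) \<Rightarrow> 's \<Rightarrow> real" where
  "grid_discount \<alpha> h n g x =
     (\<Sum>k<n. exp (- \<alpha> * h) ^ k * of_bool ((\<forall>i<k. g (h * real i) \<noteq> x) \<and> g (h * real k) = x))"

lemma grid_discount_first:
  assumes "k < n" "g (h * real k) = x" "\<And>i. i < k \<Longrightarrow> g (h * real i) \<noteq> x"
  shows "grid_discount \<alpha> h n g x = exp (- \<alpha> * h) ^ k"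
proof -
  have "grid_discount \<alpha> h n g x = (\<Sum>j<n. if j = k then exp (- \<alpha> * h) ^ k else 0)"
    unfolding grid_discount_def
  proof (rule sum.cong[OF refl])
    fix j assume "j \<in> {..<n}"
    consider "j < k" | "j = k" | "k < j" by linarith
    then show "exp (- \<alpha> * h) ^ j * of_bool ((\<forall>i<j. g (h * real i) \<noteq> x) \<and> g (h * real j) = x)
        = (if j = k then exp (- \<alpha> * h) ^ k else 0)"
      by cases (use assms in auto)
  qed
  then show ?thesis using assms(1) by simp
qed

lemma grid_discount_bounds:
  assumes "0 \<le> \<alpha>" "0 \<le> h"
  shows "0 \<le> grid_discount \<alpha> h n g x" "grid_discount \<alpha> h n g x \<le> 1"
proof -
  show "0 \<le> grid_discount \<alpha> h n g x"
    unfolding grid_discount_def by (intro sum_nonneg) auto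
  show "grid_discount \<alpha> h n g x \<le> 1"
  proof (cases "\<exists>k<n. g (h * real k) = x")
    case True
    then obtain l where "l < n" "g (h * real l) = x" by blast
    define k where "k = (LEAST k. g (h * real k) = x)"
    have "k < n"
      using Least_le[of "\<lambda>k. g (h * real k) = x", OF \<open>g (h * real l) = x\<close>] \<open>l < n\<close>
      unfolding k_def by linarith
    moreover have "g (h * real k) = x"
      unfolding k_def by (rule LeastI) fact
    moreover have "g (h * real i) \<noteq> x" if "i < k" for i
      using not_less_Least[OF that[unfolded k_def]] .
    ultimately have "grid_discount \<alpha> h n g x = exp (- \<alpha> * h) ^ k"
      by (rule grid_discount_first)
    also have "\<dots> \<le> 1" using assms by (intro power_le_one) auto
    finally show ?thesis .
  next
    case False
    then have "grid_discount \<alpha> h n g x = 0"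
      unfolding grid_discount_def by (intro sum.neutral) auto
    then show ?thesis by simp
  qed
qed

lemma right_continuous_discrete:
  fixes g :: "real \<Rightarrow> 's::discrete_topology"
  assumes "continuous (at_right t) g"
  obtains b where "t < b" "\<And>r. t \<le> r \<Longrightarrow> r < b \<Longrightarrow> g r = g t"
proof -
  have "(g \<longlongrightarrow> g t) (at_right t)"
    using assms by (simp add: continuous_within)
  then have "\<forall>\<^sub>F r in at_right t. g r \<in> {g t}"
    using topological_tendstoD[OF _ discrete_topology_class.open_discrete, of g "g t" _ "{g t}"] by blast
  then obtain b where b: "b > t" "\<And>r. r > t \<Longrightarrow> r < b \<Longrightarrow> g r = g t"
    unfolding eventually_at_right_field by auto
  with that show ?thesis by (metis order_le_less)
qed

text \<open>Mesh \<open>1 / Suc m\<close> with \<open>(Suc m)\<^sup>2\<close> steps refines the grid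
  while its horizon \<open>Suc m\<close> grows to infinity. If the path reaches \<open>x\<close> at
  all, it stays there on some interval [\<open>T\<close>, \<open>b\<close>), and every fine enough
  grid has its first visit inside that interval.\<close>

lemma grid_discount_tendsto:
  fixes g :: "real \<Rightarrow> 's::discrete_topology"
  assumes cont: "\<And>t. 0 \<le> t \<Longrightarrow> continuous (at_right t) g"
  shows "(\<lambda>m. grid_discount \<alpha> (1 / real (Suc m)) ((Suc m)\<^sup>2) g x)
     \<longlonglongrightarrow> discount \<alpha> (Inf {ereal t | t. 0 < t \<and> g t = x})"
proof (cases "\<exists>t\<ge>0. g t = x")
  case False
  then have e: "{ereal t | t. 0 < t \<and> g t = x} = {}" by (auto simp: less_imp_le)
  have "grid_discount \<alpha> (1 / real (Suc m)) ((Suc m)\<^sup>2) g x = 0" for m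
    unfolding grid_discount_def using False by (intro sum.neutral) auto
  then show ?thesis unfolding e by (simp add: discount_def top_ereal_def del: of_nat_Suc)
next
  case True
  define A where "A = {t. 0 \<le> t \<and> g t = x}"
  define T where "T = Inf A"
  have A: "A \<noteq> {}" "bdd_below A" using True by (auto simp: A_def)
  have "0 \<le> T" unfolding T_def using A by (intro cInf_greatest) (auto simp: A_def)
  have before: "g t \<noteq> x" if "0 \<le> t" "t < T" for t
    using that cInf_lower[OF _ A(2), of t] by (auto simp: T_def A_def)
  obtain b where b: "T < b" "\<And>r. T \<le> r \<Longrightarrow> r < b \<Longrightarrow> g r = g T"
    using right_continuous_discrete[OF cont[OF \<open>0 \<le> T\<close>]] by blast
  obtain t where "t \<in> A" "t < b"
    using cInf_lessD[OF A(1)] b(1) unfolding T_def by blast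
  then have "g T = x"
    using b(2)[of t] before[of t] by (force simp: A_def)
  with b have at: "g r = x" if "T \<le> r" "r < b" for r using that by simp
  have hit: "Inf {ereal t | t. 0 < t \<and> g t = x} = ereal T"
  proof (rule antisym)
    show "ereal T \<le> Inf {ereal t | t. 0 < t \<and> g t = x}"
      by (intro Inf_greatest) (auto, metis before less_imp_le not_le)
    show "Inf {ereal t | t. 0 < t \<and> g t = x} \<le> ereal T"
    proof (rule ereal_le_epsilon2)
      fix e :: real assume "0 < e"
      \<comment> \<open>A time strictly between \<open>T\<close> and \<open>b\<close>, hence
        positive even when \<open>T\<close> is 0.\<close>
      define r where "r = min (T + e) ((T + b) / 2)"
      have "T < r" "r < b" "r \<le> T + e" using \<open>0 < e\<close> b(1) by (auto simp: r_def min_def)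
      then have "Inf {ereal t | t. 0 < t \<and> g t = x} \<le> ereal r"
        using at \<open>0 \<le> T\<close> by (intro Inf_lower) auto
      also have "\<dots> \<le> ereal T + ereal e" using \<open>r \<le> T + e\<close> by simp
      finally show "Inf {ereal t | t. 0 < t \<and> g t = x} \<le> ereal T + ereal e" .
    qed
  qed
  define h where "h m = 1 / real (Suc m)" for m
  \<comment> \<open>The first grid index at or after time \<open>T\<close>.\<close>
  define k where "k m = nat \<lceil>T / h m\<rceil>" for m
  have h: "0 < h m" for m by (simp add: h_def)
  have h1: "h m \<le> 1" for m by (simp add: h_def)
  have k_ge: "T \<le> h m * real (k m)" for m
  proof -
    have "T / h m \<le> real (k m)" unfolding k_def by linarith
    then show ?thesis using h[of m] by (simp add: field_simps)
  qed
  have k_le: "h m * real (k m) < T + h m" for m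
  proof -
    have "real (k m) < T / h m + 1"
      unfolding k_def using divide_nonneg_pos[OF \<open>0 \<le> T\<close> h[of m]] by linarith
    then show ?thesis using h[of m] by (simp add: field_simps)
  qed
  have k_first: "h m * real i < T" if "i < k m" for m i
  proof -
    have "real i < T / h m" using that unfolding k_def by linarith
    then show ?thesis using h[of m] by (simp add: field_simps)
  qed
  have h0: "h \<longlonglongrightarrow> 0" unfolding h_def using LIMSEQ_inverse_real_of_nat
    by (simp add: inverse_eq_divide del: of_nat_Suc)
  have "(\<lambda>m. T + h m) \<longlonglongrightarrow> T + 0" by (intro tendsto_intros h0)
  then have "(\<lambda>m. T + h m) \<longlonglongrightarrow> T" by simp
  with tendsto_const have kT: "(\<lambda>m. h m * real (k m)) \<longlonglongrightarrow> T"
    by (rule tendsto_sandwich[rotated 2]) (use k_ge k_le in \<open>simp_all add: less_imp_le\<close>)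
  have "\<forall>\<^sub>F m in sequentially. h m * real (k m) < b"
    using order_tendstoD(2)[OF kT b(1)] .
  moreover have "\<forall>\<^sub>F m in sequentially. T < real m"
    using filterlim_real_sequentially by (auto simp: filterlim_at_top_dense)
  ultimately have "\<forall>\<^sub>F m in sequentially.
      exp (- \<alpha> * (h m * real (k m))) = grid_discount \<alpha> (1 / real (Suc m)) ((Suc m)\<^sup>2) g x"
  proof eventually_elim
    case (elim m)
    have "h m * real (k m) < real (Suc m)"
      using k_le[of m] elim(2) h1[of m] by simp
    then have "real (k m) < real ((Suc m)\<^sup>2)"
      by (simp add: h_def field_simps power2_eq_square)
    then have "k m < (Suc m)\<^sup>2" using of_nat_less_iff by blast
    then have "grid_discount \<alpha> (h m) ((Suc m)\<^sup>2) g x = exp (- \<alpha> * h m) ^ k m"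
      using at[OF k_ge elim(1)] k_first before h[of m]
      by (intro grid_discount_first) (auto simp: less_imp_le)
    then show ?case
      by (simp add: h_def exp_of_nat_mult[symmetric] mult_ac)
  qed
  moreover have "(\<lambda>m. exp (- \<alpha> * (h m * real (k m)))) \<longlonglongrightarrow> exp (- \<alpha> * T)"
    by (intro tendsto_intros kT)
  ultimately show ?thesis
    unfolding hit discount_def by (simp add: tendsto_cong)
qed

section \<open>The Markov property along the grid\<close>

lemma markov_path_step:
  assumes "prob_space M" and mk: "markov_with_semigroup M S P X" and "0 < h"
    and meas: "\<And>t. 0 \<le> t \<Longrightarrow> X t \<in> M \<rightarrow>\<^sub>M count_space S"
    and s: "\<And>i. i \<le> Suc n \<Longrightarrow> s i \<in> S"
  shows "\<P>(\<omega> in M. \<forall>i\<le>Suc n. X (h * real i) \<omega> = s i)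
    = \<P>(\<omega> in M. \<forall>i\<le>n. X (h * real i) \<omega> = s i) * P h (s n) (s (Suc n))"
proof -
  interpret prob_space M by fact
  have X[measurable]: "X (h * real i) \<in> M \<rightarrow>\<^sub>M count_space S" for i
    using \<open>0 < h\<close> by (intro meas) auto
  have [measurable]: "{\<omega> \<in> space M. \<forall>i\<le>n. X (h * real i) \<omega> = s i} \<in> sets M" for n s
    by measurable
  show ?thesis
  \<comment> \<open>The Markov hypothesis constrains only conditioning on events of positive
    probability; for null paths both sides vanish.\<close>
  proof (cases "prob {\<omega> \<in> space M. \<forall>i\<le>n. X (h * real i) \<omega> = s i} = 0")
    case True
    have "prob {\<omega> \<in> space M. \<forall>i\<le>Suc n. X (h * real i) \<omega> = s i}
        \<le> prob {\<omega> \<in> space M. \<forall>i\<le>n. X (h * real i) \<omega> = s i}"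
      by (rule finite_measure_mono) auto
    then show ?thesis using True by (simp add: measure_le_0_iff)
  next
    case False
    then have pos: "prob {\<omega> \<in> space M. \<forall>i\<le>n. X (h * real i) \<omega> = s i} > 0"
      by (simp add: zero_less_measure_iff)
    have "\<P>(\<omega> in M. X (h * real (Suc n)) \<omega> = s (Suc n) \<bar> \<forall>i\<le>n. X (h * real i) \<omega> = s i)
          = P (h * real (Suc n) - h * real n) (s n) (s (Suc n))"
      using mk[unfolded markov_with_semigroup_def, rule_format, of "\<lambda>i. h * real i" n s] pos s \<open>0 < h\<close>
      by auto
    moreover have "{\<omega> \<in> space M. X (h * real (Suc n)) \<omega> = s (Suc n) \<and> (\<forall>i\<le>n. X (h * real i) \<omega> = s i)}
      = {\<omega> \<in> space M. \<forall>i\<le>Suc n. X (h * real i) \<omega> = s i}"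
      by (auto simp: le_Suc_eq simp del: of_nat_Suc)
    moreover have "h * real (Suc n) - h * real n = h" by (simp add: algebra_simps)
    ultimately show ?thesis using pos
      by (simp add: cond_prob_def field_simps del: of_nat_Suc)
  qed
qed

text \<open>The Markov hypothesis concerns fully specified pasts only, so the event of avoiding
  \<open>x\<close> is split into finitely many paths. The set \<open>B\<close> leaves room for a
  condition on the next step: the lemma is applied both to the whole space and to the event fixing
  the state at step \<open>k + 1\<close>.\<close>

lemma measure_killed_paths:
  fixes Y :: "nat \<Rightarrow> 'a \<Rightarrow> 's"
  assumes "prob_space M" "finite S" "z \<in> S" and B: "B \<in> sets M"
    and Y: "\<And>i. Y i \<in> M \<rightarrow>\<^sub>M count_space S"
  shows "measure M {\<omega> \<in> B. (\<forall>i<k. Y i \<omega> \<noteq> x) \<and> Y k \<omega> = z}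
    = (\<Sum>s\<in>Pi\<^sub>E {..k} (\<lambda>i. if i < k then S - {x} else {z}). measure M {\<omega> \<in> B. \<forall>i\<le>k. Y i \<omega> = s i})"
proof -
  interpret prob_space M by fact
  note [measurable] = Y B
  let ?paths = "Pi\<^sub>E {..k} (\<lambda>i. if i < k then S - {x} else {z})"
  have YS: "Y i \<omega> \<in> S" if "\<omega> \<in> B" for i \<omega>
    using that measurable_space[OF Y] sets.sets_into_space[OF B] by auto
  have "{\<omega> \<in> B. (\<forall>i<k. Y i \<omega> \<noteq> x) \<and> Y k \<omega> = z}
      = (\<Union>s\<in>?paths. {\<omega> \<in> B. \<forall>i\<le>k. Y i \<omega> = s i})" (is "?L = ?R")
  proof (intro subset_antisym subsetI)
    fix \<omega> assume \<omega>: "\<omega> \<in> ?L"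
    then have "restrict (\<lambda>i. Y i \<omega>) {..k} \<in> ?paths"
      unfolding restrict_PiE_iff using YS by simp
    then show "\<omega> \<in> ?R" by (rule UN_I) (use \<omega> in simp)
  next
    fix \<omega> assume "\<omega> \<in> ?R"
    then obtain s where s: "s \<in> ?paths" and \<omega>: "\<omega> \<in> B" "\<And>i. i \<le> k \<Longrightarrow> Y i \<omega> = s i" by blast
    have "s i \<noteq> x" if "i < k" for i using PiE_mem[OF s, of i] that by simp
    moreover have "s k = z" using PiE_mem[OF s, of k] by simp
    ultimately show "\<omega> \<in> ?L" using \<omega> by simp
  qed
  also have "measure M \<dots> = (\<Sum>s\<in>?paths. measure M {\<omega> \<in> B. \<forall>i\<le>k. Y i \<omega> = s i})"
  proof (rule finite_measure_finite_Union)
    show "finite ?paths" using \<open>finite S\<close> by (intro finite_PiE) auto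
    have "{\<omega> \<in> B. \<forall>i\<le>k. Y i \<omega> = s i} = B \<inter> {\<omega> \<in> space M. \<forall>i\<le>k. Y i \<omega> = s i}" for s
      using sets.sets_into_space[OF B] by auto
    moreover have "{\<omega> \<in> space M. \<forall>i\<le>k. Y i \<omega> = s i} \<in> sets M" for s
      by measurable
    ultimately show "(\<lambda>s. {\<omega> \<in> B. \<forall>i\<le>k. Y i \<omega> = s i}) ` ?paths \<subseteq> sets M"
      using B by auto
    show "disjoint_family_on (\<lambda>s. {\<omega> \<in> B. \<forall>i\<le>k. Y i \<omega> = s i}) ?paths"
      unfolding disjoint_family_on_def
    proof (intro ballI impI equals0I)
      fix s t \<omega> assume st: "s \<in> ?paths" "t \<in> ?paths" "s \<noteq> t"
        and "\<omega> \<in> {\<omega> \<in> B. \<forall>i\<le>k. Y i \<omega> = s i} \<inter> {\<omega> \<in> B. \<forall>i\<le>k. Y i \<omega> = t i}"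
      then have "s i = t i" if "i \<in> {..k}" for i using that by auto
      with PiE_ext[OF st(1,2)] \<open>s \<noteq> t\<close> show False by blast
    qed
  qed
  finally show ?thesis .
qed

text \<open>This is the recursion that \<open>discrete_killed_sum\<close> assumes, for the
  probabilities of being at a given state without an earlier visit to \<open>x\<close>.\<close>

lemma markov_killed_step:
  assumes "prob_space M" "finite S" and mk: "markov_with_semigroup M S P X" and "0 < h"
    and meas: "\<And>t. 0 \<le> t \<Longrightarrow> X t \<in> M \<rightarrow>\<^sub>M count_space S" and "z' \<in> S"
  shows "\<P>(\<omega> in M. (\<forall>i<Suc k. X (h * real i) \<omega> \<noteq> x) \<and> X (h * real (Suc k)) \<omega> = z')
    = (\<Sum>z\<in>S - {x}. \<P>(\<omega> in M. (\<forall>i<k. X (h * real i) \<omega> \<noteq> x) \<and> X (h * real k) \<omega> = z) * P h z z')"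
proof -
  interpret prob_space M by fact
  define Y where "Y i = X (h * real i)" for i
  have Y[measurable]: "Y i \<in> M \<rightarrow>\<^sub>M count_space S" for i
    unfolding Y_def using \<open>0 < h\<close> by (intro meas) auto
  define B where "B = {\<omega> \<in> space M. Y (Suc k) \<omega> = z'}"
  have B[measurable]: "B \<in> sets M" unfolding B_def by measurable
  let ?paths = "\<lambda>z. Pi\<^sub>E {..k} (\<lambda>i. if i < k then S - {x} else {z})"
  have one: "measure M {\<omega> \<in> B. (\<forall>i<k. Y i \<omega> \<noteq> x) \<and> Y k \<omega> = z}
      = measure M {\<omega> \<in> space M. (\<forall>i<k. Y i \<omega> \<noteq> x) \<and> Y k \<omega> = z} * P h z z'"
    if "z \<in> S" for z
  proof -
    have "measure M {\<omega> \<in> B. \<forall>i\<le>k. Y i \<omega> = s i}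
        = measure M {\<omega> \<in> space M. \<forall>i\<le>k. Y i \<omega> = s i} * P h z z'" if s: "s \<in> ?paths z" for s
    proof -
      have sS: "s i \<in> S" if "i \<le> k" for i
        using PiE_mem[OF s, of i] that \<open>z \<in> S\<close> by (auto split: if_splits)
      have sk: "s k = z" using PiE_mem[OF s, of k] by simp
      define t where "t = s(Suc k := z')"
      have t: "t i = s i" if "i \<le> k" for i using that by (simp add: t_def)
      have "{\<omega> \<in> B. \<forall>i\<le>k. Y i \<omega> = s i} = {\<omega> \<in> space M. \<forall>i\<le>Suc k. Y i \<omega> = t i}"
        by (auto simp: B_def le_Suc_eq t_def)
      also have "measure M \<dots> = measure M {\<omega> \<in> space M. \<forall>i\<le>k. Y i \<omega> = t i} * P h (t k) (t (Suc k))"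
        unfolding Y_def
        by (rule markov_path_step[OF _ mk])
           (use assms sS in \<open>auto simp: t_def le_Suc_eq\<close>)
      also have "\<dots> = measure M {\<omega> \<in> space M. \<forall>i\<le>k. Y i \<omega> = s i} * P h z z'"
        using t sk by (simp add: t_def cong: conj_cong)
      finally show ?thesis .
    qed
    then show ?thesis
      using measure_killed_paths[OF \<open>prob_space M\<close> \<open>finite S\<close> \<open>z \<in> S\<close> B, of Y k x]
        measure_killed_paths[OF \<open>prob_space M\<close> \<open>finite S\<close> \<open>z \<in> S\<close> sets.top, of Y k x]
      by (simp add: sum_distrib_right)
  qed
  have YS: "Y i \<omega> \<in> S" if "\<omega> \<in> space M" for i \<omega>
    using that measurable_space[OF Y] by auto
  have "{\<omega> \<in> space M. (\<forall>i<Suc k. Y i \<omega> \<noteq> x) \<and> Y (Suc k) \<omega> = z'}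
      = (\<Union>z\<in>S - {x}. {\<omega> \<in> B. (\<forall>i<k. Y i \<omega> \<noteq> x) \<and> Y k \<omega> = z})"
    using YS by (auto simp: B_def less_Suc_eq)
  also have "measure M \<dots> = (\<Sum>z\<in>S - {x}. measure M {\<omega> \<in> B. (\<forall>i<k. Y i \<omega> \<noteq> x) \<and> Y k \<omega> = z})"
  proof (rule finite_measure_finite_Union)
    have "{\<omega> \<in> B. (\<forall>i<k. Y i \<omega> \<noteq> x) \<and> Y k \<omega> = z}
        = B \<inter> {\<omega> \<in> space M. (\<forall>i<k. Y i \<omega> \<noteq> x) \<and> Y k \<omega> = z}" for z
      by (auto simp: B_def)
    moreover have "{\<omega> \<in> space M. (\<forall>i<k. Y i \<omega> \<noteq> x) \<and> Y k \<omega> = z} \<in> sets M" for z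
      by measurable
    ultimately show "(\<lambda>z. {\<omega> \<in> B. (\<forall>i<k. Y i \<omega> \<noteq> x) \<and> Y k \<omega> = z}) ` (S - {x}) \<subseteq> sets M"
      using B by auto
  qed (use \<open>finite S\<close> in \<open>auto simp: disjoint_family_on_def\<close>)
  also have "\<dots> = (\<Sum>z\<in>S - {x}. measure M {\<omega> \<in> space M. (\<forall>i<k. Y i \<omega> \<noteq> x) \<and> Y k \<omega> = z} * P h z z')"
    by (intro sum.cong refl one) auto
  finally show ?thesis unfolding Y_def .
qed

section \<open>From the grid to continuous time\<close>

text \<open>The first-order terms of the discount and of the semigroup cancel by
  \<open>harm\<close>, so the one-step defect is o(h). It is divided by
  \<open>1 - exp (- \<alpha> * h)\<close>, which is of order h, because the defect bound of the
  discrete chain has this denominator.\<close>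

lemma one_step_error_tendsto:
  assumes "transition_semigroup S P" "has_transition_rates S P q" "finite S" "z \<in> S" "0 < \<alpha>"
    and harm: "(\<Sum>y\<in>S. q z y * (F y - F z)) = \<alpha> * F z"
  shows "((\<lambda>h. \<bar>exp (- \<alpha> * h) * (\<Sum>y\<in>S. P h z y * F y) - F z\<bar> / (1 - exp (- \<alpha> * h))) \<longlongrightarrow> 0) (at_right 0)"
proof -
  have "((\<lambda>h. P h z y / h * (F y - F z)) \<longlongrightarrow> q z y * (F y - F z)) (at_right 0)" if "y \<in> S" for y
  proof (cases "y = z")
    case False
    then show ?thesis
      using assms that by (intro tendsto_intros) (auto simp: has_transition_rates_def)
  qed simp
  then have "((\<lambda>h. \<Sum>y\<in>S. P h z y / h * (F y - F z)) \<longlongrightarrow> \<alpha> * F z) (at_right 0)"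
    unfolding harm[symmetric] by (intro tendsto_sum)
  moreover have "((\<lambda>h. exp (- \<alpha> * h)) \<longlongrightarrow> 1) (at_right 0)"
    by real_asymp
  moreover have "((\<lambda>h. h / (1 - exp (- \<alpha> * h))) \<longlongrightarrow> inverse \<alpha>) (at_right 0)"
    using \<open>0 < \<alpha>\<close> by real_asymp
  \<comment> \<open>This is the quotient in the conclusion, without the absolute value, after the
    row sum 1 has been used to replace \<open>F y\<close> by \<open>F y - F z\<close>; the
    discounted \<open>F z\<close> left over turns the quotient's last term into
    \<open>- F z\<close>.\<close>
  ultimately have "((\<lambda>h. (exp (- \<alpha> * h) * (\<Sum>y\<in>S. P h z y / h * (F y - F z))) * (h / (1 - exp (- \<alpha> * h))) - F z)
      \<longlongrightarrow> (1 * (\<alpha> * F z)) * inverse \<alpha> - F z) (at_right 0)"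
    by (intro tendsto_intros)
  also have "(1 * (\<alpha> * F z)) * inverse \<alpha> - F z = 0" using \<open>0 < \<alpha>\<close> by simp
  finally have "((\<lambda>h. \<bar>(exp (- \<alpha> * h) * (\<Sum>y\<in>S. P h z y / h * (F y - F z))) * (h / (1 - exp (- \<alpha> * h))) - F z\<bar>)
      \<longlongrightarrow> 0) (at_right 0)"
    by (rule tendsto_rabs_zero)
  moreover have "\<forall>\<^sub>F h in at_right 0.
      \<bar>(exp (- \<alpha> * h) * (\<Sum>y\<in>S. P h z y / h * (F y - F z))) * (h / (1 - exp (- \<alpha> * h))) - F z\<bar>
      = \<bar>exp (- \<alpha> * h) * (\<Sum>y\<in>S. P h z y * F y) - F z\<bar> / (1 - exp (- \<alpha> * h))"
    using eventually_at_right_less[of 0]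
  proof eventually_elim
    case (elim h)
    define c where "c = exp (- \<alpha> * h)"
    have c: "c < 1" using elim \<open>0 < \<alpha>\<close> by (simp add: c_def)
    have "(\<Sum>y\<in>S. P h z y * F y) = (\<Sum>y\<in>S. P h z y * (F y - F z)) + (\<Sum>y\<in>S. P h z y) * F z"
      by (simp add: sum_distrib_right sum_subtractf right_diff_distrib)
    also have "(\<Sum>y\<in>S. P h z y) = 1"
      using assms elim by (auto simp: transition_semigroup_def)
    also have "(\<Sum>y\<in>S. P h z y * (F y - F z)) = h * (\<Sum>y\<in>S. P h z y / h * (F y - F z))"
      using elim by (simp add: sum_distrib_left)
    finally have "c * (\<Sum>y\<in>S. P h z y * F y) - F z
        = (c * (\<Sum>y\<in>S. P h z y / h * (F y - F z)) * (h / (1 - c)) - F z) * (1 - c)"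
      using c by (simp add: field_simps)
    then show ?case
      using c unfolding c_def[symmetric] by (simp add: abs_mult)
  qed
  ultimately show ?thesis by (rule Lim_transform_eventually)
qed

text \<open>The equation for \<open>F\<close> is imposed only off \<open>x\<close>. Starting at
  \<open>x\<close> itself is covered: the path then stays at \<open>x\<close> for a while, the
  hitting time is 0, and both sides are 1.\<close>

lemma expectation_discount_hitting_time:
  fixes X :: "real \<Rightarrow> 'a \<Rightarrow> 's::discrete_topology"
  assumes proc: "markov_jump_process M S q X" and S: "x \<in> S" "z0 \<in> S" and "0 < \<alpha>"
    and harm: "\<And>z. z \<in> S - {x} \<Longrightarrow> (\<Sum>y\<in>S. q z y * (F y - F z)) = \<alpha> * F z" and "F x = 1"
    and start: "AE \<omega> in M. X 0 \<omega> = z0"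
  shows "prob_space.expectation M (\<lambda>\<omega>. discount \<alpha> (hitting_time X x \<omega>)) = F z0"
proof -
  interpret prob_space M using proc by (simp add: markov_jump_process_def)
  have fin: "finite S" and X: "\<And>t. 0 \<le> t \<Longrightarrow> X t \<in> M \<rightarrow>\<^sub>M count_space S"
    and cont: "\<And>\<omega> t. \<omega> \<in> space M \<Longrightarrow> 0 \<le> t \<Longrightarrow> continuous (at_right t) (\<lambda>r. X r \<omega>)"
    using proc by (auto simp: markov_jump_process_def)
  obtain P where P: "transition_semigroup S P" "has_transition_rates S P q" "markov_with_semigroup M S P X"
    using proc by (auto simp: markov_jump_process_def)
  define h where "h m = 1 / real (Suc m)" for m
  define c where "c m = exp (- \<alpha> * h m)" for m
  define D where "D m \<omega> = grid_discount \<alpha> (h m) ((Suc m)\<^sup>2) (\<lambda>t. X t \<omega>) x" for m \<omega>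
  \<comment> \<open>At \<open>z = x\<close> this is the probability that the first grid visit to
    \<open>x\<close> occurs at step \<open>k\<close>.\<close>
  define w where "w m k z = prob {\<omega> \<in> space M. (\<forall>i<k. X (h m * real i) \<omega> \<noteq> x) \<and> X (h m * real k) \<omega> = z}" for m k z
  have h: "0 < h m" for m by (simp add: h_def)
  have c: "0 < c m" "c m < 1" for m using h[of m] \<open>0 < \<alpha>\<close> by (auto simp: c_def)
  have X_grid[measurable]: "X (h m * real i) \<in> M \<rightarrow>\<^sub>M count_space S" for m i
    using h[of m] by (intro X) auto
  have ev[measurable]: "{\<omega> \<in> space M. (\<forall>i<k. X (h m * real i) \<omega> \<noteq> x) \<and> X (h m * real k) \<omega> = z} \<in> sets M" for m k z
    by measurable
  have D_ind: "D m \<omega> = (\<Sum>k<(Suc m)\<^sup>2. c m ^ k *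
      indicator {\<omega> \<in> space M. (\<forall>i<k. X (h m * real i) \<omega> \<noteq> x) \<and> X (h m * real k) \<omega> = x} \<omega>)"
    if "\<omega> \<in> space M" for m \<omega>
    using that unfolding D_def grid_discount_def c_def by (intro sum.cong) (auto simp: indicator_def)
  have D_meas: "D m \<in> borel_measurable M" for m
    by (subst measurable_cong[OF D_ind]) measurable
  have exp_D: "expectation (D m) = (\<Sum>k<(Suc m)\<^sup>2. c m ^ k * w m k x * F x)" for m
  proof -
    have "expectation (D m) = expectation (\<lambda>\<omega>. \<Sum>k<(Suc m)\<^sup>2. c m ^ k *
        indicator {\<omega> \<in> space M. (\<forall>i<k. X (h m * real i) \<omega> \<noteq> x) \<and> X (h m * real k) \<omega> = x} \<omega>)"
      by (intro Bochner_Integration.integral_cong D_ind) auto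
    also have "\<dots> = (\<Sum>k<(Suc m)\<^sup>2. c m ^ k * w m k x)"
      unfolding w_def
      by (subst Bochner_Integration.integral_sum)
         (auto intro!: integrable_real_mult_indicator finite_measure.emeasure_finite simp del: indicator_simps
            simp: less_top[symmetric])
    finally show ?thesis using \<open>F x = 1\<close> by simp
  qed
  have "w m 0 z = (if z = z0 then 1 else 0)" for m z
  proof -
    have "w m 0 z = prob {\<omega> \<in> space M. z = z0}"
      unfolding w_def by (rule measure_eq_AE) (use start in \<open>auto intro: X ev[of 0 m, simplified]\<close>)
    then show ?thesis by (simp add: prob_space)
  qed
  then have start_F: "(\<Sum>z\<in>S. w m 0 z * F z) = F z0" for m
    using fin S by (simp add: if_distrib[of "\<lambda>t. t * _"] cong: if_cong)
  have bound: "\<bar>expectation (D m) - F z0\<bar>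
      \<le> exp (- \<alpha> * real (Suc m)) * (\<Sum>z\<in>S. \<bar>F z\<bar>)
        + (\<Sum>z\<in>S - {x}. \<bar>c m * (\<Sum>y\<in>S. P (h m) z y * F y) - F z\<bar> / (1 - c m))" for m
  proof -
    \<comment> \<open>The grid covers the time span \<open>Suc m\<close>, so the remainder term
      decays exponentially in m.\<close>
    have "c m ^ ((Suc m)\<^sup>2) = exp (- \<alpha> * real (Suc m))"
      unfolding c_def h_def exp_of_nat_mult[symmetric] by (simp add: power2_eq_square field_simps)
    then show ?thesis
      unfolding exp_D start_F[of m, symmetric] sum_divide_distrib[symmetric]
      using discrete_killed_sum_bound[where w = "w m" and p = "P (h m)" and n = "(Suc m)\<^sup>2", OF fin S(1) c, of m F]
        markov_killed_step[OF prob_space_axioms fin P(3) h X]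
      by (simp add: w_def)
  qed
  have h0: "filterlim h (at_right 0) sequentially"
    unfolding h_def by real_asymp
  have "(\<lambda>m. exp (- \<alpha> * real (Suc m))) \<longlonglongrightarrow> 0"
    using \<open>0 < \<alpha>\<close> by real_asymp
  moreover have "(\<lambda>m. \<bar>c m * (\<Sum>y\<in>S. P (h m) z y * F y) - F z\<bar> / (1 - c m)) \<longlonglongrightarrow> 0" if "z \<in> S - {x}" for z
    unfolding c_def
    by (rule filterlim_compose[OF one_step_error_tendsto[OF P(1,2) fin _ \<open>0 < \<alpha>\<close> harm] h0])
       (use that in auto)
  ultimately have "(\<lambda>m. exp (- \<alpha> * real (Suc m)) * (\<Sum>z\<in>S. \<bar>F z\<bar>)
        + (\<Sum>z\<in>S - {x}. \<bar>c m * (\<Sum>y\<in>S. P (h m) z y * F y) - F z\<bar> / (1 - c m)))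
      \<longlonglongrightarrow> 0 * (\<Sum>z\<in>S. \<bar>F z\<bar>) + (\<Sum>z\<in>S - {x}. 0)"
    by (intro tendsto_intros)
  then have "(\<lambda>m. exp (- \<alpha> * real (Suc m)) * (\<Sum>z\<in>S. \<bar>F z\<bar>)
        + (\<Sum>z\<in>S - {x}. \<bar>c m * (\<Sum>y\<in>S. P (h m) z y * F y) - F z\<bar> / (1 - c m))) \<longlonglongrightarrow> 0"
    by simp
  then have "(\<lambda>m. expectation (D m) - F z0) \<longlonglongrightarrow> 0"
    by (rule Lim_null_comparison[OF always_eventually, rotated]) (use bound in auto)
  then have lim1: "(\<lambda>m. expectation (D m)) \<longlonglongrightarrow> F z0"
    by (rule LIM_zero_cancel)
  have D_lim: "(\<lambda>m. D m \<omega>) \<longlonglongrightarrow> discount \<alpha> (hitting_time X x \<omega>)" if "\<omega> \<in> space M" for \<omega>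
    using grid_discount_tendsto[OF cont[OF that]] unfolding D_def h_def hitting_time_def .
  have "(\<lambda>m. expectation (D m)) \<longlonglongrightarrow> expectation (\<lambda>\<omega>. discount \<alpha> (hitting_time X x \<omega>))"
  proof (rule integral_dominated_convergence[where w = "\<lambda>_. 1"])
    show "(\<lambda>\<omega>. discount \<alpha> (hitting_time X x \<omega>)) \<in> borel_measurable M"
      using D_lim D_meas by (rule borel_measurable_LIMSEQ_real)
    show "AE \<omega> in M. norm (D m \<omega>) \<le> 1" for m
      using h[of m] \<open>0 < \<alpha>\<close> unfolding D_def
      by (intro AE_I2) (simp add: grid_discount_bounds less_imp_le)
  qed (use D_lim D_meas in auto)
  then show ?thesis using lim1 LIMSEQ_unique by blast
qed

section \<open>The integrals \<open>ehrenfest_B\<close>\<close>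

text \<open>For \<alpha> < 1 the integrand is unbounded at 0. Gauge integrability and nonnegativity
  give Lebesgue integrability on the completed measure, which transfers to
  \<open>lborel\<close>.\<close>

lemma set_integrable_powr_from_0:
  assumes "0 < (\<alpha>::real)"
  shows "set_integrable lborel {0..1} (\<lambda>u::real. u powr (\<alpha> - 1))"
proof -
  have "(\<lambda>u::real. u powr (\<alpha> - 1)) integrable_on {0..1}"
    using has_integral_powr_from_0[of "\<alpha> - 1" 1] assms by auto
  then have "(\<lambda>u::real. u powr (\<alpha> - 1)) absolutely_integrable_on {0..1}"
    by (rule nonnegative_absolutely_integrable_1) auto
  then show ?thesis
    unfolding set_integrable_def by (simp add: integrable_completion)
qed

lemma set_integrable_mult_powr:
  assumes "0 < (\<alpha>::real)" "continuous_on UNIV f"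
  shows "set_integrable lborel {0..1} (\<lambda>u::real. f u * u powr (\<alpha> - 1))"
proof -
  have [measurable]: "f \<in> borel_measurable borel"
    using assms(2) by (rule borel_measurable_continuous_onI)
  have "compact (f ` {0..1})"
    by (intro compact_continuous_image continuous_on_subset[OF assms(2)]) auto
  then obtain K where K: "\<And>u. u \<in> {0..1} \<Longrightarrow> \<bar>f u\<bar> \<le> K"
    using compact_imp_bounded bounded_iff by (metis imageI real_norm_def)
  have "set_integrable lborel {0..1} (\<lambda>u. K * u powr (\<alpha> - 1))"
    using set_integrable_powr_from_0[OF assms(1)] by (intro set_integrable_mult_right) auto
  then show ?thesis
  proof (rule set_integrable_bound)
    show "set_borel_measurable lborel {0..1} (\<lambda>u. f u * u powr (\<alpha> - 1))"
      unfolding set_borel_measurable_def by measurable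
    have "norm (f u * u powr (\<alpha> - 1)) \<le> norm (K * u powr (\<alpha> - 1))" if "u \<in> {0..1}" for u
      using K[OF that] by (auto simp: abs_mult intro!: mult_right_mono)
    then show "AE u in lborel. u \<in> {0..1} \<longrightarrow> norm (f u * u powr (\<alpha> - 1)) \<le> norm (K * u powr (\<alpha> - 1))"
      by simp
  qed
qed

text \<open>The integrand is the derivative of \<open>u powr \<alpha> * f u\<close> on the open
  interval. The boundary terms vanish, at 0 because \<alpha> is positive and at 1 because
  \<open>f 1 = 0\<close>. The interior form of the fundamental theorem avoids differentiating at
  0.\<close>

lemma integral_by_parts_powr:
  fixes f f' :: "real \<Rightarrow> real"
  assumes "0 < \<alpha>" "\<And>u. (f has_real_derivative f' u) (at u)" "continuous_on UNIV f'" "f 1 = 0"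
  shows "(LBINT u:{0..1}. (\<alpha> * f u + u * f' u) * u powr (\<alpha> - 1)) = 0"
proof -
  have cf: "continuous_on A f" for A
    using assms(2) by (meson DERIV_isCont continuous_at_imp_continuous_on)
  have "((\<lambda>u. (\<alpha> * f u + u * f' u) * u powr (\<alpha> - 1)) has_integral 1 powr \<alpha> * f 1 - 0 powr \<alpha> * f 0) {0..1}"
  proof (rule fundamental_theorem_of_calculus_interior)
    show "continuous_on {0..1} (\<lambda>u. u powr \<alpha> * f u)"
      using assms(1) by (intro continuous_intros cf continuous_on_powr') auto
    fix u :: real assume u: "u \<in> {0<..<1}"
    then have "u powr \<alpha> = u * u powr (\<alpha> - 1)" by (simp add: powr_diff)
    then have "((\<lambda>u. u powr \<alpha> * f u) has_real_derivative (\<alpha> * f u + u * f' u) * u powr (\<alpha> - 1)) (at u)"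
      using u by (auto intro!: derivative_eq_intros assms(2) simp: algebra_simps)
    then show "((\<lambda>u. u powr \<alpha> * f u) has_vector_derivative (\<alpha> * f u + u * f' u) * u powr (\<alpha> - 1)) (at u)"
      by (simp add: has_real_derivative_iff_has_vector_derivative)
  qed simp
  then have "integral {0..1} (\<lambda>u. (\<alpha> * f u + u * f' u) * u powr (\<alpha> - 1)) = 0"
    using assms by (simp add: integral_unique)
  moreover have "set_integrable lborel {0..1} (\<lambda>u. (\<alpha> * f u + u * f' u) * u powr (\<alpha> - 1))"
    by (intro set_integrable_mult_powr continuous_intros cf assms)
  ultimately show ?thesis
    by (simp add: set_borel_integral_eq_integral(2))
qed

text \<open>The integrand is positive on (0, 1), so a zero integral would make that interval a null
  set. Positivity is what permits division by \<open>ehrenfest_B\<close>.\<close>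

lemma ehrenfest_B_pos:
  assumes "0 < \<nu>" "0 < \<mu>" "0 < \<alpha>"
  shows "0 < ehrenfest_B N \<nu> \<mu> x \<alpha>"
proof -
  define f where "f u = (1 - u) ^ x * (1 + \<nu> / \<mu> * u) ^ (N - x) * u powr (\<alpha> - 1)" for u
  have f_pos: "0 < f u" if "0 < u" "u < 1" for u
    using that assms by (auto simp: f_def intro!: mult_pos_pos zero_less_power add_pos_pos)
  have f_nonneg: "0 \<le> indicator {0..1} u * f u" for u
    using assms by (auto simp: f_def indicator_def)
  have int: "integrable lborel (\<lambda>u. indicator {0..1} u * f u)"
  proof -
    have "continuous_on UNIV (\<lambda>u. (1 - u) ^ x * (1 + \<nu> / \<mu> * u) ^ (N - x))"
      by (intro continuous_intros)
    from set_integrable_mult_powr[OF assms(3) this] show ?thesis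
      by (simp only: f_def set_integrable_def real_scaleR_def)
  qed
  have "(\<integral>u. indicator {0..1} u * f u \<partial>lborel) \<noteq> 0"
  proof
    assume "(\<integral>u. indicator {0..1} u * f u \<partial>lborel) = 0"
    then have "AE u in lborel. indicator {0..1} u * f u = 0"
      using integral_nonneg_eq_0_iff_AE[OF int] f_nonneg by simp
    then have "AE u in lborel. u \<notin> {0<..<1::real}"
      by eventually_elim (use f_pos in \<open>fastforce simp: indicator_def\<close>)
    then have "emeasure lborel {0<..<1::real} = 0"
      by (subst (asm) AE_iff_null_sets[symmetric]) auto
    then show False by simp
  qed
  moreover have "0 \<le> (\<integral>u. indicator {0..1} u * f u \<partial>lborel)"
    using f_nonneg by (intro integral_nonneg_AE) auto
  ultimately show ?thesis
    unfolding ehrenfest_B_def set_lebesgue_integral_def f_def by simp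
qed

lemma ehrenfest_B_recursion:
  assumes "0 < \<nu>" "0 < \<mu>" "\<mu> + \<nu> = 1" "0 < \<alpha>" "0 < z" "z \<le> N"
  shows "\<nu> * (real N - real z) * (ehrenfest_B N \<nu> \<mu> (z + 1) \<alpha> - ehrenfest_B N \<nu> \<mu> z \<alpha>)
    + \<mu> * real z * (ehrenfest_B N \<nu> \<mu> (z - 1) \<alpha> - ehrenfest_B N \<nu> \<mu> z \<alpha>)
    = \<alpha> * ehrenfest_B N \<nu> \<mu> z \<alpha>"
proof -
  define r where "r = \<nu> / \<mu>"
  define f where "f z u = (1 - u) ^ z * (1 + r * u) ^ (N - z)" for z and u :: real
  define f' where "f' u = (1 - u) ^ z * (real (N - z) * (1 + r * u) ^ (N - z - 1) * r)
      - real z * (1 - u) ^ (z - 1) * (1 + r * u) ^ (N - z)" for u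
  have r: "\<mu> * r = \<nu>" "\<mu> * (1 + r) = 1"
    using assms by (auto simp: r_def field_simps)
  have cont: "continuous_on UNIV (f z)" for z unfolding f_def by (intro continuous_intros)
  have B: "ehrenfest_B N \<nu> \<mu> z \<alpha> = (LBINT u:{0..1}. f z u * u powr (\<alpha> - 1))" for z
    unfolding ehrenfest_B_def f_def r_def ..
  have int: "set_integrable lborel {0..1} (\<lambda>u. f z u * u powr (\<alpha> - 1))" for z
    by (intro set_integrable_mult_powr cont assms)
  \<comment> \<open>Neighbouring functions \<open>f\<close> differ by a factor \<open>1 - u\<close>
    against \<open>1 + r * u\<close>, so each difference produces \<open>(1 + r) * u\<close>, and
    \<mu> cancels \<open>1 + r\<close>. What remains are the two terms of the product rule in
    \<open>f'\<close>.\<close>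
  have alg: "\<nu> * (real N - real z) * (f (z + 1) u - f z u) + \<mu> * real z * (f (z - 1) u - f z u)
      = - u * f' u" for u
  proof -
    obtain a where a: "z = Suc a" using assms(5) gr0_implies_Suc by blast
    have "\<mu> * (f (z - 1) u - f z u) = \<mu> * (1 + r) * (u * (1 - u) ^ a * (1 + r * u) ^ (N - z))"
      using assms(6) unfolding f_def a by (simp add: Suc_diff_Suc[symmetric] Suc_diff_le algebra_simps)
    then have 1: "\<mu> * real z * (f (z - 1) u - f z u) = real z * (u * (1 - u) ^ a * (1 + r * u) ^ (N - z))"
      using r by (simp add: mult_ac)
    have 2: "\<nu> * (real N - real z) * (f (z + 1) u - f z u)
        = - u * ((1 - u) ^ z * (real (N - z) * (1 + r * u) ^ (N - z - 1) * r))"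
    \<comment> \<open>At \<open>z = N\<close> the rate factor is 0, so the value of \<open>f\<close>
      beyond the state space does not matter.\<close>
    proof (cases "z = N")
      case False
      then obtain b where b: "N = z + Suc b" using assms(6) by (metis le_neq_implies_less less_natE add_Suc_right)
      have "\<nu> * (f (z + 1) u - f z u) = - (\<mu> * (1 + r)) * (r * u * (1 - u) ^ z * (1 + r * u) ^ b)"
        unfolding r(1)[symmetric] f_def b by (simp add: algebra_simps)
      then have "\<nu> * (f (z + 1) u - f z u) = - (r * u * (1 - u) ^ z * (1 + r * u) ^ b)"
        using r by simp
      moreover have "\<nu> * (real N - real z) * (f (z + 1) u - f z u)
          = real (Suc b) * (\<nu> * (f (z + 1) u - f z u))"
        by (simp add: b)
      ultimately show ?thesis by (simp add: b)
    qed simp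
    show ?thesis unfolding 1 2 f'_def by (simp add: a algebra_simps)
  qed
  have "(LBINT u:{0..1}. (\<alpha> * f z u + u * f' u) * u powr (\<alpha> - 1)) = 0"
  proof (rule integral_by_parts_powr)
    show "(f z has_real_derivative f' u) (at u)" for u
      unfolding f_def f'_def by (auto intro!: derivative_eq_intros)
    show "continuous_on UNIV f'" unfolding f'_def by (intro continuous_intros)
  qed (use assms in \<open>auto simp: f_def\<close>)
  moreover have "(\<alpha> * f z u + u * f' u) * u powr (\<alpha> - 1) =
      \<alpha> * (f z u * u powr (\<alpha> - 1))
      - \<nu> * (real N - real z) * (f (z + 1) u * u powr (\<alpha> - 1) - f z u * u powr (\<alpha> - 1))
      - \<mu> * real z * (f (z - 1) u * u powr (\<alpha> - 1) - f z u * u powr (\<alpha> - 1))" for u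
    using arg_cong[OF alg[of u], of "\<lambda>t. t * u powr (\<alpha> - 1)"] by (simp add: algebra_simps)
  ultimately show ?thesis
    unfolding B by (simp add: int set_integral_diff set_integrable_mult_right)
qed

section \<open>The discounted harmonic function of the Ehrenfest rates\<close>

text \<open>Reflecting the state space, z to \<open>N - z\<close>, exchanges \<nu> and
  \<mu>.\<close>

lemma ehrenfest_D_conv_B:
  "x \<le> N \<Longrightarrow> ehrenfest_D N \<nu> \<mu> x \<alpha> = ehrenfest_B N \<mu> \<nu> (N - x) \<alpha>"
  unfolding ehrenfest_D_def ehrenfest_B_def by simp

text \<open>Valid at both ends as well: the neighbour \<open>N + 1\<close> and the truncated
  \<open>0 - 1\<close> come with coefficient 0.\<close>

lemma sum_ehrenfest_rate:
  assumes "z \<le> N"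
  shows "(\<Sum>y\<in>{0..N}. ehrenfest_rate N \<nu> \<mu> z y * g y)
    = \<nu> * (real N - real z) * g (z + 1) + \<mu> * real z * g (z - 1)"
proof -
  have "ehrenfest_rate N \<nu> \<mu> z y * g y = (if y = z + 1 then \<nu> * (real N - real z) * g (z + 1) else 0)
      + (if y = z - 1 then \<mu> * real z * g (z - 1) else 0)" for y
    by (auto simp: ehrenfest_rate_def)
  then show ?thesis
    using assms by (cases "z = N") (auto simp: sum.distrib)
qed

lemma ehrenfest_discounted_harmonic:
  fixes N x :: nat and \<nu> \<mu> \<alpha> :: real
  defines "F \<equiv> \<lambda>z. if x \<le> z then ehrenfest_B N \<nu> \<mu> z \<alpha> / ehrenfest_B N \<nu> \<mu> x \<alpha>
      else ehrenfest_D N \<nu> \<mu> z \<alpha> / ehrenfest_D N \<nu> \<mu> x \<alpha>"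
  assumes "0 < \<nu>" "0 < \<mu>" "\<mu> + \<nu> = 1" "0 < \<alpha>" "x \<le> N" "z \<le> N" "z \<noteq> x"
  shows "(\<Sum>y\<in>{0..N}. ehrenfest_rate N \<nu> \<mu> z y * (F y - F z)) = \<alpha> * F z"
proof -
  note sum_F = sum_ehrenfest_rate[OF \<open>z \<le> N\<close>, of \<nu> \<mu> "\<lambda>y. F y - F z"]
  let ?B = "\<lambda>z. ehrenfest_B N \<nu> \<mu> z \<alpha>" and ?D = "\<lambda>z. ehrenfest_D N \<nu> \<mu> z \<alpha>"
  have Bx: "?B x > 0" using assms by (intro ehrenfest_B_pos)
  have Dx: "?D x > 0" using assms by (simp add: ehrenfest_D_conv_B ehrenfest_B_pos)
  \<comment> \<open>\<open>F\<close> takes the B-branch at \<open>x\<close>, but both branches equal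
    1 there. In this form the left-hand case can also use \<open>F (z + 1)\<close> when
    \<open>z + 1 = x\<close>.\<close>
  have Fx: "F x = ?D x / ?D x" using Bx Dx by (simp add: F_def)
  show ?thesis
  proof (cases "x < z")
    case True
    then have F: "F z = ?B z / ?B x" "F (z + 1) = ?B (z + 1) / ?B x" "F (z - 1) = ?B (z - 1) / ?B x"
      by (auto simp: F_def)
    have "\<nu> * (real N - real z) * (F (z + 1) - F z) + \<mu> * real z * (F (z - 1) - F z)
        = (\<nu> * (real N - real z) * (?B (z + 1) - ?B z) + \<mu> * real z * (?B (z - 1) - ?B z)) / ?B x"
      unfolding F by (simp add: add_divide_distrib diff_divide_distrib algebra_simps)
    also have "\<dots> = \<alpha> * F z"
      using ehrenfest_B_recursion[of \<nu> \<mu> \<alpha> z N] assms True F by simp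
    finally show ?thesis unfolding sum_F .
  next
    case False
    then have "z < x" using assms by simp
    then have F: "F z = ?D z / ?D x" "F (z + 1) = ?D (z + 1) / ?D x" "F (z - 1) = ?D (z - 1) / ?D x"
      using Fx by (auto simp: F_def le_Suc_eq)
    \<comment> \<open>The recursion for B at \<open>N - z\<close> with \<nu> and \<mu> exchanged;
      \<open>z < x\<close> and \<open>x \<le> N\<close> make \<open>N - z\<close> positive, as that
      recursion requires.\<close>
    have rec: "\<nu> * (real N - real z) * (?D (z + 1) - ?D z) + \<mu> * real z * (?D (z - 1) - ?D z) = \<alpha> * ?D z"
      using ehrenfest_B_recursion[of \<mu> \<nu> \<alpha> "N - z" N] assms \<open>z < x\<close>
      by (cases z) (simp_all add: ehrenfest_D_conv_B of_nat_diff Suc_diff_Suc algebra_simps)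
    have "\<nu> * (real N - real z) * (F (z + 1) - F z) + \<mu> * real z * (F (z - 1) - F z)
        = (\<nu> * (real N - real z) * (?D (z + 1) - ?D z) + \<mu> * real z * (?D (z - 1) - ?D z)) / ?D x"
      unfolding F by (simp add: add_divide_distrib diff_divide_distrib algebra_simps)
    also have "\<dots> = \<alpha> * F z" using rec F by simp
    finally show ?thesis unfolding sum_F .
  qed
qed

theorem proposition3:
  fixes M :: "'a measure" and E :: "real \<Rightarrow> 'a \<Rightarrow> nat"
    and N x y :: nat and \<nu> \<mu> \<alpha> :: real
  assumes "\<mu> > 0" "\<nu> > 0" "\<mu> + \<nu> = 1"
    and "N \<ge> 1"
    and "ehrenfest_process M N \<nu> \<mu> E"
    and "x \<le> y" "y \<le> N"
    and "\<alpha> > 0"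
  shows "((AE \<omega> in M. E 0 \<omega> = y) \<longrightarrow>
            prob_space.expectation M (\<lambda>\<omega>. discount \<alpha> (hitting_time E x \<omega>))
              = ehrenfest_B N \<nu> \<mu> y \<alpha> / ehrenfest_B N \<nu> \<mu> x \<alpha>)
       \<and> ((AE \<omega> in M. E 0 \<omega> = x) \<longrightarrow>
            prob_space.expectation M (\<lambda>\<omega>. discount \<alpha> (hitting_time E y \<omega>))
              = ehrenfest_D N \<nu> \<mu> x \<alpha> / ehrenfest_D N \<nu> \<mu> y \<alpha>)"
proof -
  define F where "F x z = (if x \<le> z then ehrenfest_B N \<nu> \<mu> z \<alpha> / ehrenfest_B N \<nu> \<mu> x \<alpha>
      else ehrenfest_D N \<nu> \<mu> z \<alpha> / ehrenfest_D N \<nu> \<mu> x \<alpha>)" for x z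
  have proc: "markov_jump_process M {0..N} (ehrenfest_rate N \<nu> \<mu>) E"
    using assms(5) by (simp add: ehrenfest_process_def)
  have B: "ehrenfest_B N \<nu> \<mu> a \<alpha> \<noteq> 0" for a
    using ehrenfest_B_pos[of \<nu> \<mu> \<alpha> N a] assms by simp
  have D: "ehrenfest_D N \<nu> \<mu> y \<alpha> \<noteq> 0"
    using ehrenfest_B_pos[of \<mu> \<nu> \<alpha> N "N - y"] assms by (simp add: ehrenfest_D_conv_B)
  have main: "prob_space.expectation M (\<lambda>\<omega>. discount \<alpha> (hitting_time E a \<omega>)) = F a z"
    if "a \<le> N" "z \<le> N" "AE \<omega> in M. E 0 \<omega> = z" for a z
  proof (rule expectation_discount_hitting_time[OF proc])
    show "(\<Sum>v\<in>{0..N}. ehrenfest_rate N \<nu> \<mu> u v * (F a v - F a u)) = \<alpha> * F a u"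
      if "u \<in> {0..N} - {a}" for u
      unfolding F_def using that \<open>a \<le> N\<close> assms by (intro ehrenfest_discounted_harmonic) auto
    show "F a a = 1" using B by (simp add: F_def)
  qed (use that assms in auto)
  have "F x y = ehrenfest_B N \<nu> \<mu> y \<alpha> / ehrenfest_B N \<nu> \<mu> x \<alpha>"
    using assms by (simp add: F_def)
  \<comment> \<open>For \<open>x = y\<close> the definition of \<open>F\<close> selects the
    B-quotient, but both quotients are then 1.\<close>
  moreover have "F y x = ehrenfest_D N \<nu> \<mu> x \<alpha> / ehrenfest_D N \<nu> \<mu> y \<alpha>"
    using assms B D by (cases "x = y") (simp_all add: F_def)
  ultimately show ?thesis
    using main[of x y] main[of y x] assms by auto
qed

end
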